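(* Let $n\ge2$, let $\lambda_1\ge\dots\ge\lambda_n$ be nonzero real numbers with $\lambda_1>0$ and $\lambda_n<0$, and let $x^0\in\mathbb{R}^n$ with $x^0_i\ge 0$ and $x^0_i\neq 0$ for all $i=1,\dots,n$. Let $f(\mu)=\sum_{i=1}^n\lambda_i\left(\frac{x^0_i}{1+\mu\lambda_i}\right)^2-1$, $e_1=-\frac1{\lambda_1}$, $e_2=-\frac1{\lambda_n}$ and $\mathcal I=\,]e_1,e_2[$. Then the optimal solution of $$\min_{x\in\mathbb{R}^n}\|x-x^0\|_2^2\quad\text{s.t.}\quad\sum_{i=1}^n\lambda_ix_i^2-1=0$$ is given by the unique root $\mu^*$ of $f$ restricted to $\mathcal I$; that is, the optimal solution is $x(\mu^* )$, where $x_i(\mu)=\frac{x^0_i}{1+\mu\lambda_i}$ for $i=1,\dots,n$. *)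

theory Defs
  imports "HOL-Analysis.Analysis"
begin

text \<open>Vectors in n-dimensional space are indexed by a finite linearly ordered type, whose elements
  play the role of 1, ..., n in increasing order; the first index is \<open>Min UNIV\<close> and the
  last index is \<open>Max UNIV\<close>.\<close>

definition secular :: "real ^ 'n \<Rightarrow> real ^ 'n \<Rightarrow> real \<Rightarrow> real"
  where "secular lam x0 \<mu> = (\<Sum>i\<in>UNIV. lam $ i * (x0 $ i / (1 + \<mu> * lam $ i))\<^sup>2) - 1"

definition xsol :: "real ^ 'n \<Rightarrow> real ^ 'n \<Rightarrow> real \<Rightarrow> real ^ 'n"
  where "xsol lam x0 \<mu> = (\<chi> i. x0 $ i / (1 + \<mu> * lam $ i))"

definition e1 :: "real ^ 'n::{finite,linorder} \<Rightarrow> real"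
  where "e1 lam = - 1 / lam $ Min UNIV"

definition e2 :: "real ^ 'n::{finite,linorder} \<Rightarrow> real"
  where "e2 lam = - 1 / lam $ Max UNIV"

definition feasible :: "real ^ 'n \<Rightarrow> real ^ 'n \<Rightarrow> bool"
  where "feasible lam x \<longleftrightarrow> (\<Sum>i\<in>UNIV. lam $ i * (x $ i)\<^sup>2) - 1 = 0"

definition optimal_solution :: "real ^ 'n \<Rightarrow> real ^ 'n \<Rightarrow> real ^ 'n \<Rightarrow> bool"
  where "optimal_solution lam x0 = is_arg_min (\<lambda>x. (norm (x - x0))\<^sup>2) (feasible lam)"

end

theory Submission
  imports Defs
begin

text \<open>
  Why the theorem is true. On the interval between \<open>e1\<close> and \<open>e2\<close> all the
  denominators \<open>1 + \<mu> * lam $ i\<close> are positive: each is affine in \<open>lam $ i\<close>, so it is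
  enough that the two extreme ones are. This positivity has two consequences.

  First, every summand of the secular function is strictly decreasing in \<open>\<mu>\<close>, whatever the sign of
  \<open>lam $ i\<close> (lemma \<open>secular_strict_decreasing\<close>). The function tends to
  \<open>\<infinity>\<close> at \<open>e1\<close>, where the positive summand of the first index blows up, and to
  \<open>-\<infinity>\<close> at \<open>e2\<close>, where the negative summand of the last index does
  (lemmas \<open>secular_unbounded_above\<close> and \<open>secular_unbounded_below\<close>). The intermediate
  value theorem gives a root, and monotonicity makes it unique.

  Second, the Lagrangian at \<open>\<mu>\<close> is a strictly convex quadratic, with minimiser
  \<open>xsol lam x0 \<mu>\<close>. Completing the square shows that, for feasible \<open>x\<close> and
  feasible \<open>p = xsol lam x0 \<mu>\<close>, the objective at \<open>x\<close> exceeds that at \<open>p\<close> by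
  \<open>\<Sum>i. (1 + \<mu> * lam $ i) * (x $ i - p $ i)\<^sup>2\<close>
  (lemma \<open>objective_excess\<close>). The nonconvexity of the feasible set is therefore harmless:
  \<open>p\<close> is the unique global minimiser. That \<open>p\<close> is feasible is exactly the equation
  \<open>secular lam x0 \<mu> = 0\<close>.
\<close>

lemma feasible_xsol_iff: "feasible lam (xsol lam x0 \<mu>) \<longleftrightarrow> secular lam x0 \<mu> = 0"
  by (simp add: feasible_def xsol_def secular_def)

lemma denominator_pos:
  fixes lam :: "real ^ 'n::{finite,linorder}"
  assumes mono: "\<And>i j. i \<le> j \<Longrightarrow> lam $ i \<ge> lam $ j"
    and first: "lam $ Min UNIV > 0" and last: "lam $ Max UNIV < 0"
    and \<mu>: "\<mu> \<in> {e1 lam<..<e2 lam}"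
  shows "1 + \<mu> * lam $ i > 0"
proof -
  have upper: "lam $ i \<le> lam $ Min UNIV" and lower: "lam $ Max UNIV \<le> lam $ i"
    by (auto intro!: mono)
  have at_first: "1 + \<mu> * lam $ Min UNIV > 0" and at_last: "1 + \<mu> * lam $ Max UNIV > 0"
    using \<mu> first last by (auto simp: e1_def e2_def field_simps)
  show ?thesis
  proof (cases "\<mu> \<ge> 0")
    case True
    then show ?thesis
      using mult_left_mono[OF lower True] at_last by linarith
  next
    case False
    then show ?thesis
      using mult_left_mono_neg[OF upper, of \<mu>] at_first by linarith
  qed
qed

text \<open>The squared denominator increases with \<open>\<mu>\<close> if \<open>l > 0\<close> and decreases if
  \<open>l < 0\<close>; the factor \<open>l\<close> in front turns both cases into a decrease.\<close>

lemma secular_summand_strict_decreasing: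
  fixes l a \<mu> \<nu> :: real
  assumes "l \<noteq> 0" "a \<noteq> 0" "\<mu> < \<nu>" and pos: "1 + \<mu> * l > 0" "1 + \<nu> * l > 0"
  shows "l * (a / (1 + \<nu> * l))\<^sup>2 < l * (a / (1 + \<mu> * l))\<^sup>2"
proof (cases "l > 0")
  case True
  then have "1 + \<mu> * l < 1 + \<nu> * l"
    using assms by simp
  then have "(1 + \<mu> * l)\<^sup>2 < (1 + \<nu> * l)\<^sup>2"
    using pos by (intro power_strict_mono) auto
  then have "a\<^sup>2 / (1 + \<nu> * l)\<^sup>2 < a\<^sup>2 / (1 + \<mu> * l)\<^sup>2"
    using assms pos by (intro divide_strict_left_mono) auto
  from mult_strict_left_mono[OF this True] show ?thesis
    by (simp add: power_divide)
next
  case False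
  then have l: "l < 0"
    using assms by simp
  then have "1 + \<nu> * l < 1 + \<mu> * l"
    using assms by simp
  then have "(1 + \<nu> * l)\<^sup>2 < (1 + \<mu> * l)\<^sup>2"
    using pos by (intro power_strict_mono) auto
  then have "a\<^sup>2 / (1 + \<mu> * l)\<^sup>2 < a\<^sup>2 / (1 + \<nu> * l)\<^sup>2"
    using assms pos by (intro divide_strict_left_mono) auto
  from mult_strict_left_mono_neg[OF this l] show ?thesis
    by (simp add: power_divide)
qed

lemma secular_strict_decreasing:
  fixes lam x0 :: "real ^ 'n"
  assumes "\<And>i. lam $ i \<noteq> 0" "\<And>i. x0 $ i \<noteq> 0" "\<mu> < \<nu>"
    and "\<And>i. 1 + \<mu> * lam $ i > 0" "\<And>i. 1 + \<nu> * lam $ i > 0"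
  shows "secular lam x0 \<nu> < secular lam x0 \<mu>"
  unfolding secular_def
  using assms by (intro diff_strict_right_mono sum_strict_mono secular_summand_strict_decreasing) auto

text \<open>For \<open>\<mu> \<le> 0\<close> the negative summands are harmless, since their denominators are at
  least \<open>1\<close>; the other summands are nonnegative. So nothing compensates the summand of
  index \<open>k\<close>, which is made arbitrarily large by letting its denominator tend to \<open>0\<close>.\<close>

lemma secular_unbounded_above:
  fixes lam x0 :: "real ^ 'n"
  assumes lk: "lam $ k > 0" and xk: "x0 $ k \<noteq> 0"
  shows "\<exists>\<mu>. - 1 / lam $ k < \<mu> \<and> \<mu> \<le> 0 \<and> secular lam x0 \<mu> \<ge> B"
proof -
  define C where "C = (\<Sum>i\<in>UNIV. \<bar>lam $ i\<bar> * (x0 $ i)\<^sup>2)"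
  define c where "c = lam $ k * (x0 $ k)\<^sup>2"
  define K where "K = \<bar>B + 1 + C\<bar> / c"
  \<comment> \<open>chosen so that the denominator of index \<open>k\<close> is \<open>1 / (1 + K)\<close>\<close>
  define \<mu> where "\<mu> = (1 / (1 + K) - 1) / lam $ k"
  have c: "c > 0" and K: "K \<ge> 0"
    using lk xk by (auto simp: c_def K_def)
  have "- 1 < 1 / (1 + K) - 1" and "1 / (1 + K) - 1 \<le> 0"
    using K by auto
  then have lower: "- 1 / lam $ k < \<mu>" and upper: "\<mu> \<le> 0"
    using lk unfolding \<mu>_def by (intro divide_strict_right_mono divide_nonpos_pos; simp)+
  have summand: "lam $ i * (x0 $ i / (1 + \<mu> * lam $ i))\<^sup>2 \<ge> - (\<bar>lam $ i\<bar> * (x0 $ i)\<^sup>2)" for i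
  proof (cases "lam $ i \<ge> 0")
    case True
    then have "- (\<bar>lam $ i\<bar> * (x0 $ i)\<^sup>2) \<le> 0" "0 \<le> lam $ i * (x0 $ i / (1 + \<mu> * lam $ i))\<^sup>2"
      by auto
    then show ?thesis by linarith
  next
    case False
    then have "\<mu> * lam $ i \<ge> 0"
      using upper by (simp add: mult_nonpos_nonpos)
    then have "1 \<le> (1 + \<mu> * lam $ i)\<^sup>2"
      by (intro one_le_power) simp
    then have "(x0 $ i)\<^sup>2 / (1 + \<mu> * lam $ i)\<^sup>2 \<le> (x0 $ i)\<^sup>2 / 1"
      by (intro divide_left_mono) auto
    then have "(x0 $ i / (1 + \<mu> * lam $ i))\<^sup>2 \<le> (x0 $ i)\<^sup>2"
      by (simp add: power_divide)
    from mult_left_mono_neg[OF this, of "lam $ i"] show ?thesis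
      using False by simp
  qed
  have "\<bar>B + 1 + C\<bar> = c * K"
    using c by (simp add: K_def)
  also have "\<dots> \<le> c * (1 + K)\<^sup>2"
    using c K by (intro mult_left_mono) (auto simp: power2_eq_square algebra_simps)
  also have "\<dots> = lam $ k * (x0 $ k / (1 + \<mu> * lam $ k))\<^sup>2"
    using lk K by (simp add: \<mu>_def c_def power_mult_distrib)
  finally have peak: "B + 1 + C \<le> lam $ k * (x0 $ k / (1 + \<mu> * lam $ k))\<^sup>2"
    by linarith
  have "(\<Sum>i\<in>UNIV - {k}. \<bar>lam $ i\<bar> * (x0 $ i)\<^sup>2) \<le> C"
    unfolding C_def by (intro sum_mono2) auto
  moreover have "- (\<Sum>i\<in>UNIV - {k}. \<bar>lam $ i\<bar> * (x0 $ i)\<^sup>2)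
      \<le> (\<Sum>i\<in>UNIV - {k}. lam $ i * (x0 $ i / (1 + \<mu> * lam $ i))\<^sup>2)"
    unfolding sum_negf[symmetric] by (intro sum_mono summand)
  moreover have "secular lam x0 \<mu> = lam $ k * (x0 $ k / (1 + \<mu> * lam $ k))\<^sup>2
      + (\<Sum>i\<in>UNIV - {k}. lam $ i * (x0 $ i / (1 + \<mu> * lam $ i))\<^sup>2) - 1"
    by (simp add: secular_def sum.remove[of UNIV k])
  ultimately have "secular lam x0 \<mu> \<ge> B"
    using peak by linarith
  then show ?thesis
    using lower upper by blast
qed

text \<open>Changing the signs of \<open>lam\<close> and \<open>\<mu>\<close> keeps the denominators and negates the
  sum, which exchanges the two ends of the interval.\<close>

lemma secular_reflect: "secular (- lam) x0 (- \<mu>) = - secular lam x0 \<mu> - 2"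
  by (simp add: secular_def sum_negf)

lemma secular_unbounded_below:
  fixes lam x0 :: "real ^ 'n"
  assumes "lam $ k < 0" "x0 $ k \<noteq> 0"
  shows "\<exists>\<mu>. 0 \<le> \<mu> \<and> \<mu> < - 1 / lam $ k \<and> secular lam x0 \<mu> \<le> B"
proof -
  obtain \<mu> where "- 1 / (- lam) $ k < \<mu>" "\<mu> \<le> 0" "secular (- lam) x0 \<mu> \<ge> - B - 2"
    using secular_unbounded_above[of "- lam" k x0 "- B - 2"] assms by auto
  then show ?thesis
    using secular_reflect[of lam x0 "- \<mu>"] by (intro exI[of _ "- \<mu>"]) auto
qed

text \<open>With \<open>d = 1 + \<mu> * lam $ i\<close> and \<open>p $ i = x0 $ i / d\<close>, completing the square gives
  \<open>(t - x0 $ i)\<^sup>2 + \<mu> * lam $ i * t\<^sup>2 = d * (t - p $ i)\<^sup>2 + const\<close> for every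
  \<open>t\<close>. Comparing \<open>t = x $ i\<close> with \<open>t = p $ i\<close> and summing, the multiples
  of \<open>\<mu>\<close> cancel because both points satisfy the constraint.\<close>

lemma objective_excess:
  fixes lam x0 x :: "real ^ 'n"
  assumes d: "\<And>i. 1 + \<mu> * lam $ i \<noteq> 0"
    and x: "feasible lam x" and p: "feasible lam (xsol lam x0 \<mu>)"
  shows "(norm (x - x0))\<^sup>2 = (norm (xsol lam x0 \<mu> - x0))\<^sup>2
    + (\<Sum>i\<in>UNIV. (1 + \<mu> * lam $ i) * (x $ i - xsol lam x0 \<mu> $ i)\<^sup>2)"
proof -
  let ?p = "xsol lam x0 \<mu>"
  have norm_sum: "(norm y)\<^sup>2 = (\<Sum>i\<in>UNIV. (y $ i)\<^sup>2)" for y :: "real ^ 'n"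
    by (simp add: norm_vec_def L2_set_def sum_nonneg)
  have square: "(x $ i - x0 $ i)\<^sup>2 = (?p $ i - x0 $ i)\<^sup>2 + (1 + \<mu> * lam $ i) * (x $ i - ?p $ i)\<^sup>2
      + \<mu> * (lam $ i * (?p $ i)\<^sup>2) - \<mu> * (lam $ i * (x $ i)\<^sup>2)" for i
  proof -
    have x0: "x0 $ i = (1 + \<mu> * lam $ i) * ?p $ i"
      using d[of i] by (simp add: xsol_def)
    show ?thesis
      unfolding x0 by (simp add: power2_eq_square algebra_simps)
  qed
  have "(\<Sum>i\<in>UNIV. (x $ i - x0 $ i)\<^sup>2) = (\<Sum>i\<in>UNIV. (?p $ i - x0 $ i)\<^sup>2)
      + (\<Sum>i\<in>UNIV. (1 + \<mu> * lam $ i) * (x $ i - ?p $ i)\<^sup>2)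
      + \<mu> * (\<Sum>i\<in>UNIV. lam $ i * (?p $ i)\<^sup>2) - \<mu> * (\<Sum>i\<in>UNIV. lam $ i * (x $ i)\<^sup>2)"
    by (subst square) (simp only: sum.distrib sum_subtractf sum_distrib_left)
  then show ?thesis
    using x p by (simp add: norm_sum feasible_def)
qed

lemma optimal_solution_iff_xsol:
  fixes lam x0 :: "real ^ 'n"
  assumes d: "\<And>i. 1 + \<mu> * lam $ i > 0" and root: "secular lam x0 \<mu> = 0"
  shows "optimal_solution lam x0 x \<longleftrightarrow> x = xsol lam x0 \<mu>"
proof -
  let ?p = "xsol lam x0 \<mu>"
  let ?D = "\<lambda>y. \<Sum>i\<in>UNIV. (1 + \<mu> * lam $ i) * (y $ i - ?p $ i)\<^sup>2"
  have p: "feasible lam ?p"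
    using root by (simp add: feasible_xsol_iff)
  have excess: "(norm (y - x0))\<^sup>2 = (norm (?p - x0))\<^sup>2 + ?D y" if "feasible lam y" for y
    using objective_excess[OF _ that p] d by (metis less_irrefl)
  have nonneg: "?D y \<ge> 0" for y
    using d by (intro sum_nonneg mult_nonneg_nonneg) (auto simp: less_imp_le)
  have zero: "y = ?p" if "?D y \<le> 0" for y
  proof -
    have "?D y = 0"
      using that nonneg[of y] by linarith
    then have "\<forall>i\<in>UNIV. (1 + \<mu> * lam $ i) * (y $ i - ?p $ i)\<^sup>2 = 0"
      using d by (subst (asm) sum_nonneg_eq_0_iff) (auto simp: less_imp_le)
    then show ?thesis
      using d by (auto simp: vec_eq_iff) (metis less_irrefl)
  qed
  show ?thesis
  proof
    assume "optimal_solution lam x0 x"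
    then have x: "feasible lam x" and "\<not> (norm (?p - x0))\<^sup>2 < (norm (x - x0))\<^sup>2"
      using p by (auto simp: optimal_solution_def is_arg_min_def)
    then show "x = ?p"
      using excess[OF x] by (intro zero) linarith
  next
    assume "x = ?p"
    moreover have "\<not> (norm (y - x0))\<^sup>2 < (norm (?p - x0))\<^sup>2" if "feasible lam y" for y
      using excess[OF that] nonneg[of y] by linarith
    ultimately show "optimal_solution lam x0 x"
      using p unfolding optimal_solution_def is_arg_min_def by blast
  qed
qed

theorem proposition2p12:
  fixes lam x0 :: "real ^ 'n::{finite,linorder}"
  assumes "CARD('n) \<ge> 2"
    and "\<And>i j. i \<le> j \<Longrightarrow> lam $ i \<ge> lam $ j"
    and "\<And>i. lam $ i \<noteq> 0"
    and "lam $ Min UNIV > 0"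
    and "lam $ Max UNIV < 0"
    and "\<And>i. x0 $ i \<ge> 0"
    and "\<And>i. x0 $ i \<noteq> 0"
  shows "\<exists>\<mu>\<in>{e1 lam<..<e2 lam}.
      secular lam x0 \<mu> = 0 \<and>
      (\<forall>\<nu>\<in>{e1 lam<..<e2 lam}. secular lam x0 \<nu> = 0 \<longrightarrow> \<nu> = \<mu>) \<and>
      (\<forall>x. optimal_solution lam x0 x \<longleftrightarrow> x = xsol lam x0 \<mu>)"
proof -
  have pos: "1 + \<mu> * lam $ i > 0" if "\<mu> \<in> {e1 lam<..<e2 lam}" for \<mu> i
    using assms(2,4,5) that by (rule denominator_pos)
  obtain a where a: "e1 lam < a" "a \<le> 0" "secular lam x0 a \<ge> 0"
    using secular_unbounded_above[of lam "Min UNIV" x0 0] assms(4,7) by (auto simp: e1_def)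
  obtain b where b: "0 \<le> b" "b < e2 lam" "secular lam x0 b \<le> 0"
    using secular_unbounded_below[of lam "Max UNIV" x0 0] assms(5,7) by (auto simp: e2_def)
  have "\<forall>\<mu>\<in>{a..b}. \<forall>i. 1 + \<mu> * lam $ i \<noteq> 0"
    using pos a b by (metis atLeastAtMost_iff greaterThanLessThan_iff le_less_trans less_irrefl
        less_le_trans)
  then have "continuous_on {a..b} (secular lam x0)"
    unfolding secular_def by (intro continuous_intros) auto
  then obtain \<mu> where "a \<le> \<mu>" "\<mu> \<le> b" and root: "secular lam x0 \<mu> = 0"
    using IVT2'[of "secular lam x0" b 0 a] a b by auto
  then have \<mu>: "\<mu> \<in> {e1 lam<..<e2 lam}"
    using a b by auto
  have "\<nu> = \<mu>" if "\<nu> \<in> {e1 lam<..<e2 lam}" "secular lam x0 \<nu> = 0" for \<nu>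
    using secular_strict_decreasing[OF assms(3,7) _ pos pos, of \<mu> \<nu>]
      secular_strict_decreasing[OF assms(3,7) _ pos pos, of \<nu> \<mu>] \<mu> root that
    by (metis less_irrefl linorder_neqE)
  then show ?thesis
    using \<mu> root optimal_solution_iff_xsol[OF pos[OF \<mu>] root] by blast
qed

end
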